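(* Let $n\ge 2$ be an integer, let $c_8>0$ be a constant, let $0<\gamma_1,\gamma_2<1$, and let $\mathbf d=(d_1,d_2)\in\mathbb{R}^2$ with $d_1\neq d_2$. For $Q>1$ let $\Pi=I_1\times I_2\subset\mathbb{R}^2$ be the rectangle with midpoint $\mathbf d$ and side lengths $\mu_1I_i=c_8Q^{-\gamma_i}$, $i=1,2$. Then there is $Q_0=Q_0(n,\gamma_1,\gamma_2,\mathbf d)$ such that for all $Q>Q_0$ $$\#\mathcal{A}_n^2(Q,\Pi)<c_{12}\,Q^{n+1}\mu_2\Pi,\qquad c_{12}=2^{3n+9}n^2\rho_n(d_1)\rho_n(d_2)|d_1-d_2|^{-1},$$ where $\rho_n(x)=\big((|x|+1)^{n+1}-1\big)|x|^{-1}$ for $x\neq0$ and $\rho_n(0)=n+1$.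
   Context: For $P(t)=a_mt^m+\dots+a_0\in\mathbb{Z}[t]$, the height is $H(P)=\max_j|a_j|$. A point $\boldsymbol\alpha=(\alpha_1,\alpha_2)$ is an algebraic point if $\alpha_1$ and $\alpha_2$ are roots of the same irreducible polynomial in $\mathbb{Z}[t]$; its minimal polynomial is the polynomial $P\in\mathbb{Z}[t]$ of smallest degree ($\ge2$) with coprime coefficients such that $P(\alpha_1)=P(\alpha_2)=0$, and $\deg\boldsymbol\alpha=\deg P$, $H(\boldsymbol\alpha)=H(P)$. $\mathcal{A}_n^2(Q)$ is the set of algebraic points with $\deg\boldsymbol\alpha\le n$ and $H(\boldsymbol\alpha)\le Q$, and $\mathcal{A}_n^2(Q,D)=\mathcal{A}_n^2(Q)\cap D$ for $D\subset\mathbb{R}^2$. $\mu_1,\mu_2$ denote Lebesgue measure on $\mathbb{R}$, $\mathbb{R}^2$.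
   Formalization: Q_0 is allowed to depend on the constant c_8 as well as on n, γ_1, γ_2 and d; with Q_0 independent of c_8 the bound fails as c_8 → 0 when d is itself an algebraic point, e.g. d = (√2, −√2). *)

theory Defs
  imports "HOL-Analysis.Analysis" "HOL-Computational_Algebra.Polynomial_Factorial"
begin

definition poly_height :: "int poly \<Rightarrow> int" where
  "poly_height P = Max ((\<lambda>j. \<bar>coeff P j\<bar>) ` {..degree P})"

definition vanishes_at :: "int poly \<Rightarrow> real \<times> real \<Rightarrow> bool" where
  "vanishes_at P \<alpha> \<longleftrightarrow>
     poly (map_poly of_int P) (fst \<alpha>) = 0 \<and> poly (map_poly of_int P) (snd \<alpha>) = 0"

definition algebraic_point :: "real \<times> real \<Rightarrow> bool" where
  "algebraic_point \<alpha> \<longleftrightarrow> (\<exists>P. irreducible P \<and> vanishes_at P \<alpha>)"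

(* A relation rather than a function: the minimal polynomial of an algebraic point is
   determined only up to sign, which affects neither degree nor height. (At points (r, r) with
   r rational the bound 2 on the degree even allows several minimal polynomials; no such point
   lies in a sufficiently small rectangle centred off the diagonal.) *)
definition is_minimal_poly :: "int poly \<Rightarrow> real \<times> real \<Rightarrow> bool" where
  "is_minimal_poly P \<alpha> \<longleftrightarrow>
     degree P \<ge> 2 \<and> Polynomial.content P = 1 \<and> vanishes_at P \<alpha> \<and>
     (\<forall>R. degree R \<ge> 2 \<and> Polynomial.content R = 1 \<and> vanishes_at R \<alpha> \<longrightarrow> degree P \<le> degree R)"

definition alg_points :: "nat \<Rightarrow> real \<Rightarrow> (real \<times> real) set" where
  "alg_points n Q = {\<alpha>. algebraic_point \<alpha> \<and>
     (\<exists>P. is_minimal_poly P \<alpha> \<and> degree P \<le> n \<and> real_of_int (poly_height P) \<le> Q)}"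

definition alg_points_in :: "nat \<Rightarrow> real \<Rightarrow> (real \<times> real) set \<Rightarrow> (real \<times> real) set" where
  "alg_points_in n Q D = alg_points n Q \<inter> D"

definition centered_interval :: "real \<Rightarrow> real \<Rightarrow> real set" where
  "centered_interval x l = {x - l / 2 .. x + l / 2}"

definition rho :: "nat \<Rightarrow> real \<Rightarrow> real" where
  "rho n x = (if x = 0 then real n + 1 else ((\<bar>x\<bar> + 1) ^ (n + 1) - 1) / \<bar>x\<bar>)"

definition c12 :: "nat \<Rightarrow> real \<Rightarrow> real \<Rightarrow> real" where
  "c12 n d1 d2 = 2 ^ (3 * n + 9) * (real n)\<^sup>2 * rho n d1 * rho n d2 / \<bar>d1 - d2\<bar>"

end

theory Submission
  imports Defs
begin

text \<open>
  If \<open>P\<close> has height at most \<open>Q\<close> and a root within \<open>c\<^sub>8 Q\<^sup>-\<^sup>\<gamma> / 2\<close> of \<open>d\<close>, then \<open>\<bar>P(d)\<bar>\<close> is at most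
  \<open>B = n \<rho>\<^sub>n(d) Q \<sqdot> c\<^sub>8 Q\<^sup>-\<^sup>\<gamma> / 2\<close>, by a mean value estimate. Once the coefficients of degree at least
  two are fixed, the conditions \<open>\<bar>P(d\<^sub>1)\<bar> \<le> B\<^sub>1\<close> and \<open>\<bar>P(d\<^sub>2)\<bar> \<le> B\<^sub>2\<close> confine the two remaining
  coefficients to a parallelogram of area \<open>4 B\<^sub>1 B\<^sub>2 / \<bar>d\<^sub>1 - d\<^sub>2\<bar>\<close>. Because \<open>\<gamma>\<^sub>i < 1\<close>, both \<open>B\<^sub>i\<close> tend to
  infinity with \<open>Q\<close>, so that the number of lattice points in it is bounded by a constant times its
  area. Each polynomial accounts for at most \<open>n\<^sup>2\<close> points.
\<close>

section \<open>Values of a polynomial near one of its roots\<close>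

text \<open>A geometric sum of ratio \<open>\<bar>x\<bar> + 1\<close>; at \<open>x = 0\<close> the
  ratio is 1 and every term is 1. The mean value estimate produces \<open>rho\<close> in this
  shape.\<close>

lemma rho_eq_sum: "rho n x = (\<Sum>j\<le>n. (\<bar>x\<bar> + 1) ^ j)"
proof (cases "x = 0")
  case False
  then have "(\<Sum>j<Suc n. (\<bar>x\<bar> + 1) ^ j) = ((\<bar>x\<bar> + 1) ^ Suc n - 1) / (\<bar>x\<bar> + 1 - 1)"
    by (intro geometric_sum) auto
  with False show ?thesis
    by (simp add: rho_def lessThan_Suc_atMost)
qed (simp add: rho_def)

lemma rho_ge_1: "rho n x \<ge> 1"
proof -
  have "(\<Sum>j\<in>{0}. (\<bar>x\<bar> + 1) ^ j) \<le> (\<Sum>j\<le>n. (\<bar>x\<bar> + 1) ^ j)"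
    by (rule sum_mono2) auto
  then show ?thesis
    by (simp add: rho_eq_sum)
qed

text \<open>Induction on \<open>j\<close> through
  \<open>x * (x ^ j - d ^ j) + d ^ j * (x - d)\<close>. Since \<open>1 \<le> y\<close>, the exponent
  \<open>j - 1\<close> of the derivative may be raised to \<open>j\<close>, so that summing over
  \<open>j\<close> gives exactly \<open>rho\<close>.\<close>

lemma abs_power_diff_le:
  fixes x d y :: real
  assumes "\<bar>x\<bar> \<le> y" "\<bar>d\<bar> \<le> y" "1 \<le> y"
  shows "\<bar>x ^ j - d ^ j\<bar> \<le> real j * y ^ j * \<bar>x - d\<bar>"
proof (induction j)
  case (Suc j)
  have "x ^ Suc j - d ^ Suc j = x * (x ^ j - d ^ j) + d ^ j * (x - d)"
    by (simp add: algebra_simps)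
  then have "\<bar>x ^ Suc j - d ^ Suc j\<bar> \<le> \<bar>x\<bar> * \<bar>x ^ j - d ^ j\<bar> + \<bar>d\<bar> ^ j * \<bar>x - d\<bar>"
    by (metis abs_mult abs_triangle_ineq power_abs)
  also have "\<dots> \<le> y * (real j * y ^ j * \<bar>x - d\<bar>) + y ^ Suc j * \<bar>x - d\<bar>"
  proof (intro add_mono mult_mono Suc.IH assms)
    have "\<bar>d\<bar> ^ j \<le> y ^ j"
      using assms by (intro power_mono) auto
    also have "\<dots> \<le> y ^ Suc j"
      using assms by (intro power_increasing) auto
    finally show "\<bar>d\<bar> ^ j \<le> y ^ Suc j" .
  qed (use assms in auto)
  also have "\<dots> = real (Suc j) * y ^ Suc j * \<bar>x - d\<bar>"
    by (simp add: algebra_simps)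
  finally show ?case .
qed simp

lemma poly_of_int_eq_sum:
  fixes x :: real
  assumes "degree P \<le> n"
  shows "poly (map_poly of_int P) x = (\<Sum>j\<le>n. of_int (coeff P j) * x ^ j)"
proof -
  have "poly (map_poly of_int P) x = (\<Sum>j\<le>degree P. of_int (coeff P j) * x ^ j)"
    by (simp add: poly_altdef coeff_map_poly degree_map_poly)
  also have "\<dots> = (\<Sum>j\<le>n. of_int (coeff P j) * x ^ j)"
    using assms by (intro sum.mono_neutral_left) (auto simp: coeff_eq_0)
  finally show ?thesis .
qed

text \<open>Subtract \<open>P(x) = 0\<close> from \<open>P(d)\<close> and compare powers term by
  term. As \<open>\<bar>x - d\<bar> \<le> 1\<close>, both points have absolute value at most
  \<open>\<bar>d\<bar> + 1\<close>; bounding the factor \<open>j\<close> by \<open>n\<close> leaves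
  the sum \<open>rho n d\<close>.\<close>

lemma abs_poly_le_of_root_nearby:
  fixes P :: "int poly" and Q d x :: real
  assumes "degree P \<le> n" and coeff: "\<And>j. \<bar>real_of_int (coeff P j)\<bar> \<le> Q"
    and root: "poly (map_poly of_int P) x = 0" and "\<bar>x - d\<bar> \<le> 1"
  shows "\<bar>poly (map_poly of_int P) d\<bar> \<le> real n * rho n d * Q * \<bar>x - d\<bar>"
proof -
  define y where "y = \<bar>d\<bar> + 1"
  have y: "\<bar>x\<bar> \<le> y" "\<bar>d\<bar> \<le> y" "1 \<le> y"
    using assms(4) by (auto simp: y_def)
  have Q: "0 \<le> Q"
    using coeff[of 0] by linarith
  have "poly (map_poly of_int P) d = poly (map_poly of_int P) d - poly (map_poly of_int P) x"
    using root by simp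
  also have "\<dots> = (\<Sum>j\<le>n. of_int (coeff P j) * (d ^ j - x ^ j))"
    by (simp add: poly_of_int_eq_sum[OF assms(1)] sum_subtractf algebra_simps)
  finally have "\<bar>poly (map_poly of_int P) d\<bar> \<le> (\<Sum>j\<le>n. \<bar>of_int (coeff P j) * (d ^ j - x ^ j)\<bar>)"
    by simp
  also have "\<dots> \<le> (\<Sum>j\<le>n. Q * (real n * y ^ j * \<bar>x - d\<bar>))"
  proof (rule sum_mono)
    fix j assume "j \<in> {..n}"
    then have "real j * y ^ j * \<bar>x - d\<bar> \<le> real n * y ^ j * \<bar>x - d\<bar>"
      using y by (intro mult_right_mono) auto
    then have "\<bar>d ^ j - x ^ j\<bar> \<le> real n * y ^ j * \<bar>x - d\<bar>"
      using abs_power_diff_le[OF y, of j] by (simp add: abs_minus_commute)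
    then show "\<bar>of_int (coeff P j) * (d ^ j - x ^ j)\<bar> \<le> Q * (real n * y ^ j * \<bar>x - d\<bar>)"
      unfolding abs_mult using coeff[of j] Q by (intro mult_mono) auto
  qed
  also have "\<dots> = real n * rho n d * Q * \<bar>x - d\<bar>"
    by (simp add: rho_eq_sum y_def sum_distrib_left sum_distrib_right mult_ac)
  finally show ?thesis .
qed

section \<open>Lattice points in a parallelogram\<close>

lemma finite_card_ints_abs_add_le:
  fixes s B :: real
  assumes "0 \<le> B"
  shows "finite {a :: int. \<bar>of_int a + s\<bar> \<le> B}"
    and "real (card {a :: int. \<bar>of_int a + s\<bar> \<le> B}) \<le> 2 * B + 1"
proof -
  have eq: "{a :: int. \<bar>of_int a + s\<bar> \<le> B} = {\<lceil>- s - B\<rceil>..\<lfloor>- s + B\<rfloor>}"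
    by (auto simp: ceiling_le_iff le_floor_iff)
  show "finite {a :: int. \<bar>of_int a + s\<bar> \<le> B}"
    by (simp add: eq)
  show "real (card {a :: int. \<bar>of_int a + s\<bar> \<le> B}) \<le> 2 * B + 1"
    unfolding eq card_atLeastAtMost_int using assms by linarith
qed

text \<open>The pair consists of the linear and the constant coefficient of a polynomial;
  \<open>s1\<close> and \<open>s2\<close> stand for the contributions of the higher terms at
  \<open>d1\<close> and \<open>d2\<close>.\<close>

definition lattice_parallelogram ::
  "real \<Rightarrow> real \<Rightarrow> real \<Rightarrow> real \<Rightarrow> real \<Rightarrow> real \<Rightarrow> (int \<times> int) set" where
  "lattice_parallelogram d1 d2 s1 s2 B1 B2 =
     {(a1, a0). \<bar>of_int a0 + of_int a1 * d1 + s1\<bar> \<le> B1 \<and> \<bar>of_int a0 + of_int a1 * d2 + s2\<bar> \<le> B2}"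

lemma lattice_parallelogram_commute:
  "lattice_parallelogram d1 d2 s1 s2 B1 B2 = lattice_parallelogram d2 d1 s2 s1 B2 B1"
  by (auto simp: lattice_parallelogram_def)

text \<open>Subtracting the two conditions eliminates \<open>a0\<close> and confines
  \<open>a1\<close> to an interval of length \<open>2 * (B1 + B2) / \<bar>d1 - d2\<bar>\<close>. For
  each \<open>a1\<close> the first condition confines \<open>a0\<close> to an interval of length
  \<open>2 * B1\<close>.\<close>

lemma card_lattice_parallelogram_le:
  assumes "d1 \<noteq> d2" "0 \<le> B1" "0 \<le> B2"
  shows "finite (lattice_parallelogram d1 d2 s1 s2 B1 B2)" (is "finite ?S")
    and "real (card (lattice_parallelogram d1 d2 s1 s2 B1 B2)) \<le>
           (2 * ((B1 + B2) / \<bar>d1 - d2\<bar>) + 1) * (2 * B1 + 1)"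
proof -
  define A where
    "A = {a :: int. \<bar>of_int a + (s1 - s2) / (d1 - d2)\<bar> \<le> (B1 + B2) / \<bar>d1 - d2\<bar>}"
  define F where "F a = {b :: int. \<bar>of_int b + (of_int a * d1 + s1)\<bar> \<le> B1}" for a :: int
  have "0 \<le> (B1 + B2) / \<bar>d1 - d2\<bar>"
    using assms by simp
  note A = finite_card_ints_abs_add_le[OF this, of "(s1 - s2) / (d1 - d2)", folded A_def]
  have F: "finite (F a)" "real (card (F a)) \<le> 2 * B1 + 1" for a
    unfolding F_def by (rule finite_card_ints_abs_add_le[OF assms(2)])+
  have sub: "?S \<subseteq> Sigma A F"
  proof
    fix p assume "p \<in> ?S"
    then obtain a b where p: "p = (a, b)" "\<bar>of_int b + of_int a * d1 + s1\<bar> \<le> B1"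
        "\<bar>of_int b + of_int a * d2 + s2\<bar> \<le> B2"
      by (auto simp: lattice_parallelogram_def)
    have "of_int a + (s1 - s2) / (d1 - d2) = (of_int a * (d1 - d2) + (s1 - s2)) / (d1 - d2)"
      using assms by (simp add: field_simps)
    moreover have "\<bar>of_int a * (d1 - d2) + (s1 - s2)\<bar> \<le> B1 + B2"
      using p by (simp add: algebra_simps)
    ultimately have "a \<in> A"
      by (simp add: A_def divide_right_mono)
    with p show "p \<in> Sigma A F"
      by (simp add: F_def add.assoc)
  qed
  have fin: "finite (Sigma A F)"
    using A F by auto
  then show "finite ?S"
    using sub finite_subset by blast
  have "real (card ?S) \<le> real (card (Sigma A F))"
    using card_mono[OF fin sub] by simp
  also have "\<dots> = (\<Sum>a\<in>A. real (card (F a)))"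
    using A F by (subst card_SigmaI) auto
  also have "\<dots> \<le> real (card A) * (2 * B1 + 1)"
    using sum_bounded_above[of A "\<lambda>a. real (card (F a))" "2 * B1 + 1"] F by simp
  also have "\<dots> \<le> (2 * ((B1 + B2) / \<bar>d1 - d2\<bar>) + 1) * (2 * B1 + 1)"
    using A assms by (intro mult_right_mono) auto
  finally show "real (card ?S) \<le> (2 * ((B1 + B2) / \<bar>d1 - d2\<bar>) + 1) * (2 * B1 + 1)" .
qed

text \<open>The lower bounds absorb the two summands 1:
  \<open>\<bar>d1 - d2\<bar> \<le> 4 * B2\<close> and \<open>B1 + B2 \<le> 2 * B2\<close> turn the
  first factor into \<open>8 * B2 / \<bar>d1 - d2\<bar>\<close>, and \<open>1 \<le> 2 * B1\<close>
  turns the second into \<open>4 * B1\<close>.\<close>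

lemma card_lattice_parallelogram_le_area_aux:
  assumes "d1 \<noteq> d2" "1 / 2 \<le> B1" "B1 \<le> B2" "\<bar>d1 - d2\<bar> / 4 \<le> B2"
  shows "real (card (lattice_parallelogram d1 d2 s1 s2 B1 B2)) \<le> 32 * B1 * B2 / \<bar>d1 - d2\<bar>"
proof -
  have "real (card (lattice_parallelogram d1 d2 s1 s2 B1 B2)) \<le>
      (2 * ((B1 + B2) / \<bar>d1 - d2\<bar>) + 1) * (2 * B1 + 1)"
    using assms by (intro card_lattice_parallelogram_le) auto
  also have "\<dots> \<le> (8 * B2 / \<bar>d1 - d2\<bar>) * (4 * B1)"
  proof (rule mult_mono)
    have "2 * ((B1 + B2) / \<bar>d1 - d2\<bar>) + 1 = (2 * (B1 + B2) + \<bar>d1 - d2\<bar>) / \<bar>d1 - d2\<bar>"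
      using assms by (simp add: add_divide_distrib)
    also have "\<dots> \<le> 8 * B2 / \<bar>d1 - d2\<bar>"
      using assms by (intro divide_right_mono) auto
    finally show "2 * ((B1 + B2) / \<bar>d1 - d2\<bar>) + 1 \<le> 8 * B2 / \<bar>d1 - d2\<bar>" .
  qed (use assms in auto)
  finally show ?thesis
    by (simp add: mult_ac)
qed

text \<open>The preceding count slices along the narrower strip; exchanging the two strips removes
  the assumption \<open>B1 \<le> B2\<close>.\<close>

lemma card_lattice_parallelogram_le_area:
  assumes "d1 \<noteq> d2" "1 / 2 \<le> B1" "1 / 2 \<le> B2" "\<bar>d1 - d2\<bar> / 4 \<le> B1" "\<bar>d1 - d2\<bar> / 4 \<le> B2"
  shows "real (card (lattice_parallelogram d1 d2 s1 s2 B1 B2)) \<le> 32 * B1 * B2 / \<bar>d1 - d2\<bar>"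
proof (cases "B1 \<le> B2")
  case True
  then show ?thesis
    using assms by (intro card_lattice_parallelogram_le_area_aux) auto
next
  case False
  then have "real (card (lattice_parallelogram d2 d1 s2 s1 B2 B1)) \<le> 32 * B2 * B1 / \<bar>d2 - d1\<bar>"
    using assms by (intro card_lattice_parallelogram_le_area_aux) auto
  then show ?thesis
    by (subst lattice_parallelogram_commute) (simp add: mult_ac abs_minus_commute)
qed

section \<open>Polynomials with small values at two points\<close>

definition polys_small_at :: "nat \<Rightarrow> real \<Rightarrow> real \<Rightarrow> real \<Rightarrow> real \<Rightarrow> real \<Rightarrow> int poly set" where
  "polys_small_at n Q d1 d2 B1 B2 =
     {P. P \<noteq> 0 \<and> degree P \<le> n \<and> (\<forall>j. \<bar>real_of_int (coeff P j)\<bar> \<le> Q) \<and>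
         \<bar>poly (map_poly of_int P) d1\<bar> \<le> B1 \<and> \<bar>poly (map_poly of_int P) d2\<bar> \<le> B2}"

text \<open>There are at most \<open>(2 * Q + 1) ^ (n - 1) \<le> (4 * Q) ^ (n - 1)\<close> choices
  for the coefficients of degree 2 to \<open>n\<close>. Each choice fixes the shifts of a
  parallelogram that contains the two remaining coefficients.\<close>

lemma card_polys_small_at_le:
  assumes "n \<ge> 2" "Q \<ge> 1" "d1 \<noteq> d2" "1 / 2 \<le> B1" "1 / 2 \<le> B2"
    "\<bar>d1 - d2\<bar> / 4 \<le> B1" "\<bar>d1 - d2\<bar> / 4 \<le> B2"
  shows "finite (polys_small_at n Q d1 d2 B1 B2)" (is "finite ?P")
    and "real (card (polys_small_at n Q d1 d2 B1 B2)) \<le>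
           (4 * Q) ^ (n - 1) * (32 * B1 * B2 / \<bar>d1 - d2\<bar>)"
proof -
  define C where "C = {a :: int. \<bar>of_int a\<bar> \<le> Q}"
  define T where "T = PiE {2..n} (\<lambda>_. C)"
  define s where "s f d = (\<Sum>j=2..n. of_int (f j) * d ^ j)" for f :: "nat \<Rightarrow> int" and d :: real
  define L where "L f = lattice_parallelogram d1 d2 (s f d1) (s f d2) B1 B2" for f
  \<comment> \<open>This encoding is injective on \<open>?P\<close> because coefficients beyond
    \<open>n\<close> vanish; \<open>restrict\<close> makes its first component an element of the
    function space \<open>T\<close>.\<close>
  define \<phi> where "\<phi> P = (restrict (coeff P) {2..n}, coeff P 1, coeff P 0)" for P :: "int poly"
  have C: "finite C" "real (card C) \<le> 2 * Q + 1"
    using finite_card_ints_abs_add_le[of Q 0] assms by (simp_all add: C_def)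
  have T: "finite T" "real (card T) \<le> (4 * Q) ^ (n - 1)"
  proof -
    show "finite T"
      unfolding T_def using C by (intro finite_PiE) auto
    have "real (card T) = real (card C) ^ (n - 1)"
      using assms(1) by (simp add: T_def card_PiE)
    also have "\<dots> \<le> (4 * Q) ^ (n - 1)"
      using C assms by (intro power_mono) auto
    finally show "real (card T) \<le> (4 * Q) ^ (n - 1)" .
  qed
  have L: "finite (L f)" "real (card (L f)) \<le> 32 * B1 * B2 / \<bar>d1 - d2\<bar>" for f
    unfolding L_def using assms
    by (auto intro!: card_lattice_parallelogram_le card_lattice_parallelogram_le_area)
  have "inj_on \<phi> ?P"
  proof (rule inj_onI, rule poly_eqI)
    fix P R :: "int poly" and j
    assume P: "P \<in> ?P" "R \<in> ?P" "\<phi> P = \<phi> R"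
    consider "j = 0" | "j = 1" | "j \<in> {2..n}" | "j > n"
      by fastforce
    then show "coeff P j = coeff R j"
    proof cases
      case 3
      then show ?thesis
        using P(3) by (metis \<phi>_def prod.inject restrict_apply')
    next
      case 4
      with P show ?thesis
        by (auto simp: polys_small_at_def coeff_eq_0)
    qed (use P in \<open>auto simp: \<phi>_def\<close>)
  qed
  moreover have sub: "\<phi> ` ?P \<subseteq> Sigma T L"
  proof (rule image_subsetI)
    fix P assume P: "P \<in> ?P"
    have ev: "poly (map_poly of_int P) d =
        of_int (coeff P 0) + of_int (coeff P 1) * d + s (restrict (coeff P) {2..n}) d" for d :: real
    proof -
      have "{..n} = insert 0 (insert 1 {2..n})"
        using assms(1) by auto
      then have "poly (map_poly of_int P) d =
          (\<Sum>j\<in>insert 0 (insert 1 {2..n}). of_int (coeff P j) * d ^ j)"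
        using P poly_of_int_eq_sum[of P n d] by (simp add: polys_small_at_def)
      also have "\<dots> = of_int (coeff P 0) + of_int (coeff P 1) * d + s (restrict (coeff P) {2..n}) d"
        by (simp add: s_def)
      finally show ?thesis .
    qed
    have "restrict (coeff P) {2..n} \<in> T"
      using P by (auto simp: T_def C_def polys_small_at_def)
    moreover have "(coeff P 1, coeff P 0) \<in> L (restrict (coeff P) {2..n})"
      using P by (simp add: L_def lattice_parallelogram_def polys_small_at_def ev)
    ultimately show "\<phi> P \<in> Sigma T L"
      by (simp add: \<phi>_def)
  qed
  moreover have fin: "finite (Sigma T L)"
    using T L by auto
  ultimately show "finite ?P"
    using inj_on_finite by blast
  have "real (card ?P) \<le> real (card (Sigma T L))"
    using card_inj_on_le[OF \<open>inj_on \<phi> ?P\<close> sub fin] by simp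
  also have "\<dots> = (\<Sum>f\<in>T. real (card (L f)))"
    using T L by (subst card_SigmaI) auto
  also have "\<dots> \<le> real (card T) * (32 * B1 * B2 / \<bar>d1 - d2\<bar>)"
    using sum_bounded_above[of T "\<lambda>f. real (card (L f))" "32 * B1 * B2 / \<bar>d1 - d2\<bar>"] L by simp
  also have "\<dots> \<le> (4 * Q) ^ (n - 1) * (32 * B1 * B2 / \<bar>d1 - d2\<bar>)"
    using T assms by (intro mult_right_mono) auto
  finally show "real (card ?P) \<le> (4 * Q) ^ (n - 1) * (32 * B1 * B2 / \<bar>d1 - d2\<bar>)" .
qed

section \<open>From polynomials to algebraic points\<close>

lemma abs_coeff_le_poly_height: "\<bar>coeff P j\<bar> \<le> poly_height P"
proof (cases "j \<le> degree P")
  case True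
  then show ?thesis
    by (auto simp: poly_height_def intro: Max_ge)
next
  case False
  have "0 \<le> \<bar>coeff P 0\<bar>"
    by simp
  also have "\<dots> \<le> poly_height P"
    by (auto simp: poly_height_def intro: Max_ge)
  finally show ?thesis
    using False by (simp add: coeff_eq_0)
qed

lemma finite_card_real_roots_le:
  fixes P :: "int poly"
  assumes "P \<noteq> 0" "degree P \<le> n"
  shows "finite {x :: real. poly (map_poly of_int P) x = 0}"
    and "card {x :: real. poly (map_poly of_int P) x = 0} \<le> n"
proof -
  have nz: "map_poly (of_int :: int \<Rightarrow> real) P \<noteq> 0"
    using assms by (simp add: map_poly_eq_0_iff)
  then show "finite {x :: real. poly (map_poly of_int P) x = 0}"
    by (rule poly_roots_finite)
  show "card {x :: real. poly (map_poly of_int P) x = 0} \<le> n"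
    using card_poly_roots_bound[OF nz] assms(2) by (simp add: degree_map_poly)
qed

text \<open>\<open>B1\<close> and \<open>B2\<close> are the mean value bounds at the largest
  distance \<open>l / 2\<close> from the centre, and \<open>l \<le> 2\<close> keeps that distance at
  most 1. Both coordinates of a point are among the at most \<open>n\<close> real roots of one
  polynomial, hence the factor \<open>n^2\<close>.\<close>

lemma card_alg_points_in_le:
  fixes n :: nat and Q d1 d2 l1 l2 :: real
  defines "R \<equiv> centered_interval d1 l1 \<times> centered_interval d2 l2"
    and "B1 \<equiv> real n * rho n d1 * Q * (l1 / 2)" and "B2 \<equiv> real n * rho n d2 * Q * (l2 / 2)"
  assumes "n \<ge> 2" "Q \<ge> 1" "d1 \<noteq> d2" "l1 \<le> 2" "l2 \<le> 2" "1 / 2 \<le> B1" "1 / 2 \<le> B2"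
    "\<bar>d1 - d2\<bar> / 4 \<le> B1" "\<bar>d1 - d2\<bar> / 4 \<le> B2"
  shows "finite (alg_points_in n Q R)"
    and "real (card (alg_points_in n Q R)) \<le>
           (real n)\<^sup>2 * ((4 * Q) ^ (n - 1) * (32 * B1 * B2 / \<bar>d1 - d2\<bar>))"
proof -
  define Z where "Z P = {x :: real. poly (map_poly of_int P) x = 0}" for P :: "int poly"
  let ?P = "polys_small_at n Q d1 d2 B1 B2"
  have P: "finite ?P" "real (card ?P) \<le> (4 * Q) ^ (n - 1) * (32 * B1 * B2 / \<bar>d1 - d2\<bar>)"
    by (rule card_polys_small_at_le; fact)+
  have Z: "finite (Z P)" "card (Z P) \<le> n" if "P \<in> ?P" for P
    using that unfolding Z_def polys_small_at_def by (auto intro: finite_card_real_roots_le)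
  \<comment> \<open>Covering by a union over all of \<open>?P\<close> avoids choosing one minimal
    polynomial for each point.\<close>
  have sub: "alg_points_in n Q R \<subseteq> (\<Union>P\<in>?P. Z P \<times> Z P)"
  proof
    fix \<alpha> assume \<alpha>: "\<alpha> \<in> alg_points_in n Q R"
    then obtain P where min: "is_minimal_poly P \<alpha>" and deg: "degree P \<le> n"
        and ht: "real_of_int (poly_height P) \<le> Q"
      by (auto simp: alg_points_in_def alg_points_def)
    have roots: "poly (map_poly of_int P) (fst \<alpha>) = 0" "poly (map_poly of_int P) (snd \<alpha>) = 0"
      using min by (auto simp: is_minimal_poly_def vanishes_at_def)
    have "P \<noteq> 0"
      using min by (auto simp: is_minimal_poly_def)
    have coeff: "\<bar>real_of_int (coeff P j)\<bar> \<le> Q" for j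
      using abs_coeff_le_poly_height[of P j] ht by linarith
    have near: "\<bar>fst \<alpha> - d1\<bar> \<le> l1 / 2" "\<bar>snd \<alpha> - d2\<bar> \<le> l2 / 2"
      using \<alpha> unfolding alg_points_in_def R_def centered_interval_def Int_iff mem_Times_iff
        atLeastAtMost_iff by linarith+
    have small: "\<bar>poly (map_poly of_int P) d\<bar> \<le> real n * rho n d * Q * (l / 2)"
      if "poly (map_poly of_int P) x = 0" "\<bar>x - d\<bar> \<le> l / 2" "l \<le> 2" for x d l :: real
    proof -
      have "\<bar>poly (map_poly of_int P) d\<bar> \<le> real n * rho n d * Q * \<bar>x - d\<bar>"
        using that by (intro abs_poly_le_of_root_nearby deg coeff) auto
      also have "\<dots> \<le> real n * rho n d * Q * (l / 2)"
        using that rho_ge_1[of n d] assms by (intro mult_left_mono) auto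
      finally show ?thesis .
    qed
    have "P \<in> ?P"
      using \<open>P \<noteq> 0\<close> deg coeff small[OF roots(1) near(1)] small[OF roots(2) near(2)] assms
      by (simp add: polys_small_at_def)
    moreover have "\<alpha> \<in> Z P \<times> Z P"
      using roots by (simp add: Z_def mem_Times_iff)
    ultimately show "\<alpha> \<in> (\<Union>P\<in>?P. Z P \<times> Z P)"
      by blast
  qed
  have fin: "finite (\<Union>P\<in>?P. Z P \<times> Z P)"
    using P Z by auto
  then show "finite (alg_points_in n Q R)"
    using sub finite_subset by blast
  have "card (alg_points_in n Q R) \<le> card (\<Union>P\<in>?P. Z P \<times> Z P)"
    by (rule card_mono[OF fin sub])
  also have "\<dots> \<le> (\<Sum>P\<in>?P. card (Z P \<times> Z P))"
    by (rule card_UN_le[OF P(1)])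
  also have "\<dots> \<le> (\<Sum>P\<in>?P. n * n)"
    using Z by (intro sum_mono) (auto simp: card_cartesian_product intro: mult_le_mono)
  finally have "real (card (alg_points_in n Q R)) \<le> real (card ?P * (n * n))"
    by (simp only: sum_constant of_nat_le_iff of_nat_id)
  also have "\<dots> = (real n)\<^sup>2 * real (card ?P)"
    by (simp add: power2_eq_square)
  also have "\<dots> \<le> (real n)\<^sup>2 * ((4 * Q) ^ (n - 1) * (32 * B1 * B2 / \<bar>d1 - d2\<bar>))"
    using P by (intro mult_left_mono) auto
  finally show "real (card (alg_points_in n Q R)) \<le>
      (real n)\<^sup>2 * ((4 * Q) ^ (n - 1) * (32 * B1 * B2 / \<bar>d1 - d2\<bar>))" .
qed

section \<open>Area, numerical constants and large \<open>Q\<close>\<close>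

lemma measure_centered_rectangle:
  assumes "0 \<le> l1" "0 \<le> l2"
  shows "measure lborel (centered_interval d1 l1 \<times> centered_interval d2 l2) = l1 * l2"
proof -
  have "centered_interval d1 l1 \<times> centered_interval d2 l2 =
      cbox (d1 - l1 / 2, d2 - l2 / 2) (d1 + l1 / 2, d2 + l2 / 2)"
    by (simp add: centered_interval_def cbox_Pair_eq)
  then show ?thesis
    using assms by (simp add: content_Pair)
qed

text \<open>The count yields \<open>n^4\<close>: one \<open>n^2\<close> from pairs of roots, one
  from \<open>B1 * B2\<close>. As \<open>c12\<close> has only \<open>n^2\<close>, the other is
  absorbed into its power of two. The induction step from \<open>m\<close> to \<open>m + 1\<close>
  needs \<open>2 * m + 1 \<le> m * m\<close>, which fails at \<open>m = 2\<close>, so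
  \<open>n = 3\<close> is computed directly.\<close>

lemma square_le_two_power_Suc: "n ^ 2 \<le> 2 ^ (n + 1)" for n :: nat
proof (induction n rule: less_induct)
  case (less n)
  consider "n = 0" | "n = 1" | "n = 2" | "n \<ge> 3"
    by linarith
  then show ?case
  proof cases
    case 4
    then obtain m where m: "n = Suc m" "m \<ge> 2"
      by (cases n) auto
    show ?thesis
    proof (cases "m = 2")
      case False
      with m have "3 \<le> m" by simp
      then have "2 * m + 1 \<le> 3 * m" "3 * m \<le> m * m"
        by auto
      then have "2 * m + 1 \<le> m * m"
        by (rule order_trans)
      then have "n ^ 2 \<le> 2 * m ^ 2"
        by (simp add: m power2_eq_square)
      also have "\<dots> \<le> 2 ^ (n + 1)"
        using less[of m] m by simp
      finally show ?thesis .
    qed (simp add: m)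
  qed auto
qed

text \<open>The side tends to 0 because \<open>\<gamma> > 0\<close>, while the mean value bound is
  \<open>(k * c / 2) * Q powr (1 - \<gamma>)\<close> and tends to infinity because
  \<open>\<gamma> < 1\<close>.\<close>

lemma eventually_sides_admissible:
  fixes c \<gamma> k K :: real
  assumes "c > 0" "0 < \<gamma>" "\<gamma> < 1" "k > 0"
  shows "eventually (\<lambda>Q. c * Q powr (- \<gamma>) \<le> 2 \<and> K \<le> k * Q * (c * Q powr (- \<gamma>) / 2)) at_top"
proof (rule eventually_conj)
  have "((\<lambda>Q. c * Q powr (- \<gamma>)) \<longlongrightarrow> c * 0) at_top"
    using assms by (intro tendsto_mult tendsto_const tendsto_neg_powr filterlim_ident) auto
  then have "eventually (\<lambda>Q. c * Q powr (- \<gamma>) < 2) at_top"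
    by (rule order_tendstoD) simp
  then show "eventually (\<lambda>Q. c * Q powr (- \<gamma>) \<le> 2) at_top"
    by eventually_elim simp
  have "filterlim (\<lambda>Q. (k * c / 2) * Q powr (1 - \<gamma>)) at_top at_top"
    using assms
    by (intro filterlim_tendsto_pos_mult_at_top[OF tendsto_const] real_powr_at_top) auto
  then have "eventually (\<lambda>Q. K \<le> (k * c / 2) * Q powr (1 - \<gamma>)) at_top"
    by (simp add: filterlim_at_top)
  then show "eventually (\<lambda>Q. K \<le> k * Q * (c * Q powr (- \<gamma>) / 2)) at_top"
    using eventually_gt_at_top[of 0]
    by eventually_elim (simp add: powr_diff powr_minus field_simps)
qed

theorem theorem3:
  fixes n :: nat and c8 \<gamma>1 \<gamma>2 d1 d2 :: real
  assumes "n \<ge> 2"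
    and "c8 > 0"
    and "0 < \<gamma>1" and "\<gamma>1 < 1"
    and "0 < \<gamma>2" and "\<gamma>2 < 1"
    and "d1 \<noteq> d2"
  shows "\<exists>Q0::real. \<forall>Q>1. \<forall>R. Q > Q0 \<longrightarrow>
    R = centered_interval d1 (c8 * Q powr (- \<gamma>1)) \<times> centered_interval d2 (c8 * Q powr (- \<gamma>2)) \<longrightarrow>
    finite (alg_points_in n Q R) \<and>
    real (card (alg_points_in n Q R)) < c12 n d1 d2 * Q ^ (n + 1) * measure lborel R"
proof -
  \<comment> \<open>\<open>K\<close> combines the two lower bounds on \<open>B1\<close> and
    \<open>B2\<close> under which the lattice point count is controlled by the area.\<close>
  define K where "K = max (1 / 2) (\<bar>d1 - d2\<bar> / 4)"
  have rho: "rho n d > 0" for d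
    using rho_ge_1[of n d] by linarith
  have k: "real n * rho n d > 0" for d
    using rho[of d] assms(1) by simp
  have "eventually (\<lambda>Q.
      (c8 * Q powr (- \<gamma>1) \<le> 2 \<and> K \<le> real n * rho n d1 * Q * (c8 * Q powr (- \<gamma>1) / 2)) \<and>
      (c8 * Q powr (- \<gamma>2) \<le> 2 \<and> K \<le> real n * rho n d2 * Q * (c8 * Q powr (- \<gamma>2) / 2))) at_top"
    using assms k by (intro eventually_conj eventually_sides_admissible) auto
  then obtain Q0 where Q0: "\<And>Q. Q \<ge> Q0 \<Longrightarrow>
      (c8 * Q powr (- \<gamma>1) \<le> 2 \<and> K \<le> real n * rho n d1 * Q * (c8 * Q powr (- \<gamma>1) / 2)) \<and>
      (c8 * Q powr (- \<gamma>2) \<le> 2 \<and> K \<le> real n * rho n d2 * Q * (c8 * Q powr (- \<gamma>2) / 2))"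
    unfolding eventually_at_top_linorder by blast
  have "finite (alg_points_in n Q R) \<and>
      real (card (alg_points_in n Q R)) < c12 n d1 d2 * Q ^ (n + 1) * measure lborel R"
    if Q: "Q > 1" "Q > Q0" and R: "R = centered_interval d1 (c8 * Q powr (- \<gamma>1)) \<times>
      centered_interval d2 (c8 * Q powr (- \<gamma>2))" for Q R
  proof -
    define l1 where "l1 = c8 * Q powr (- \<gamma>1)"
    define l2 where "l2 = c8 * Q powr (- \<gamma>2)"
    note R = R[folded l1_def l2_def]
    have l: "l1 > 0" "l2 > 0"
      using assms Q by (auto simp: l1_def l2_def)
    have adm: "l1 \<le> 2" "l2 \<le> 2" "K \<le> real n * rho n d1 * Q * (l1 / 2)"
        "K \<le> real n * rho n d2 * Q * (l2 / 2)"
      using Q0[of Q] Q by (auto simp: l1_def l2_def)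
    have "1 / 2 \<le> K" "\<bar>d1 - d2\<bar> / 4 \<le> K"
      by (auto simp: K_def)
    note K = this[THEN order_trans]
    note bound = card_alg_points_in_le[OF assms(1) less_imp_le[OF Q(1)] assms(7) adm(1,2)
      K(1)[OF adm(3)] K(1)[OF adm(4)] K(2)[OF adm(3)] K(2)[OF adm(4)], folded R]
    \<comment> \<open>\<open>M\<close> is the claimed bound without its power of two.\<close>
    define M where "M = (real n)\<^sup>2 * rho n d1 * rho n d2 / \<bar>d1 - d2\<bar> * Q ^ (n + 1) * (l1 * l2)"
    have M: "M > 0"
      using assms Q l rho by (simp add: M_def)
    have Qn: "Q ^ (n + 1) = Q ^ (n - 1) * Q\<^sup>2"
      using assms(1) by (simp flip: power_add)
    \<comment> \<open>The 8 is 32 divided by 4, from the two halved side lengths in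
      \<open>B1 * B2\<close>.\<close>
    have "real (card (alg_points_in n Q R)) \<le> 8 * 4 ^ (n - 1) * real (n ^ 2) * M"
      using bound(2) unfolding M_def Qn
      by (simp add: power_mult_distrib power2_eq_square mult_ac)
    also have "\<dots> \<le> 8 * 4 ^ (n - 1) * real (2 ^ (n + 1)) * M"
      using M by (intro mult_right_mono mult_left_mono of_nat_mono square_le_two_power_Suc) auto
    also have "8 * 4 ^ (n - 1) * real (2 ^ (n + 1)) = (2 :: real) ^ (3 + 2 * (n - 1) + (n + 1))"
      by (simp add: power_add power_mult)
    \<comment> \<open>The left exponent equals \<open>3 * n + 2\<close>; with \<open>M > 0\<close>
      this gives the strict inequality.\<close>
    also have "2 ^ (3 + 2 * (n - 1) + (n + 1)) * M < 2 ^ (3 * n + 9) * M"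
      using M by (intro mult_strict_right_mono power_strict_increasing) auto
    also have "\<dots> = c12 n d1 d2 * Q ^ (n + 1) * measure lborel R"
      using l by (simp add: R measure_centered_rectangle M_def c12_def mult_ac)
    finally show ?thesis
      using bound(1) by blast
  qed
  then show ?thesis
    by blast
qed

end
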